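(* Let $\hbar$ be a nonzero real number such that $\exp(\mathrm i\hbar)$ is not a root of unity ($\mathrm i=\sqrt{-1}$). Let $U$ be the complex vector space with basis $\{e_k\}_{k\in\mathbb Z}$, let $I\subset U^{\otimes2}$ be the span of the elements $\exp(\mathrm ik\hbar)\,e_k\otimes e_l-\exp(\mathrm il\hbar)\,e_l\otimes e_k$, $k,l\in\mathbb Z$, and let $\mathcal A_\hbar$ be the enveloping algebra of the $\hbar$-Witt algebra, i.e. the quotient of the tensor algebra $T(U)$ by the two-sided ideal generated by the elements $$\exp(\mathrm ik\hbar)\,e_k\otimes e_l-\exp(\mathrm il\hbar)\,e_l\otimes e_k-\frac{\exp(\mathrm il\hbar)-\exp(\mathrm ik\hbar)}{\hbar}\,e_{k+l},\qquad k,l\in\mathbb Z.$$ Then the PBW property fails for $\mathcal A_\hbar$: the canonical surjective homomorphism $T(U)/\langle I\rangle\to\mathrm{Gr}(\mathcal A_\hbar)$ is not an isomorphism.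
   Context: $\langle I\rangle$ is the two-sided ideal generated by $I$; $U$ and $U^{\otimes k}$ consist of finite linear combinations only. $\mathrm{Gr}(\mathcal A_\hbar)$ is the graded algebra associated with the filtration of $\mathcal A_\hbar$ induced by the degree filtration of $T(U)$ (each $e_k$ having degree 1); the canonical homomorphism sends $e_k$ to the class of $e_k$ in degree 1. *)

theory Defs
  imports Complex_Main "HOL-Library.Poly_Mapping"
    "HOL-Algebra.QuotRing" "HOL-Algebra.Module" "HOL-Algebra.Product_Groups"
begin

section \<open>Algebras, quotients and associated graded algebras\<close>

text \<open>
  Associative unital algebras are carried by the library's \<^typ>\<open>('k, 'a) module\<close> records. (The
  locale \<^locale>\<open>algebra\<close> is not used, as it demands commutativity.)
\<close>

definition alg_hom ::
  "('k, 'a, 'm) module_scheme \<Rightarrow> ('k, 'b, 'n) module_scheme \<Rightarrow> ('a \<Rightarrow> 'b) set"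
  where "alg_hom A B =
    {h \<in> ring_hom A B. \<forall>c. \<forall>x \<in> carrier A. h (c \<odot>\<^bsub>A\<^esub> x) = c \<odot>\<^bsub>B\<^esub> h x}"

definition alg_iso ::
  "('k, 'a, 'm) module_scheme \<Rightarrow> ('k, 'b, 'n) module_scheme \<Rightarrow> ('a \<Rightarrow> 'b) set"
  where "alg_iso A B = {h \<in> alg_hom A B. bij_betw h (carrier A) (carrier B)}"

definition quot_alg :: "('k, 'a, 'm) module_scheme \<Rightarrow> 'a set \<Rightarrow> ('k, 'a set) module"
  where "quot_alg A J = ring.extend (A Quot J)
    (module.fields (\<lambda>c X. \<Union>x\<in>X. J +>\<^bsub>A\<^esub> (c \<odot>\<^bsub>A\<^esub> x)))"

text \<open>
  \<open>F\<close> is an increasing filtration of \<open>A\<close> indexed by the natural numbers;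
  \<open>filt_below A F n\<close> is \<open>F (n - 1)\<close>, with the convention \<open>F (-1) = 0\<close>.
\<close>

definition filt_below :: "('k, 'a, 'm) module_scheme \<Rightarrow> (nat \<Rightarrow> 'a set) \<Rightarrow> nat \<Rightarrow> 'a set"
  where "filt_below A F n = (if n = 0 then {\<zero>\<^bsub>A\<^esub>} else F (n - 1))"

text \<open>The abelian group \<open>F n / F (n - 1)\<close>; its operation is written multiplicatively.\<close>

definition gr_piece :: "('k, 'a, 'm) module_scheme \<Rightarrow> (nat \<Rightarrow> 'a set) \<Rightarrow> nat \<Rightarrow> 'a set monoid"
  where "gr_piece A F n =
    \<lparr>carrier = F n, monoid.mult = add A, one = \<zero>\<^bsub>A\<^esub>\<rparr> Mod (filt_below A F n)"

text \<open>
  \<open>gr_class A F n x\<close> is the class of \<open>x \<in> F n\<close> in \<open>F n / F (n - 1)\<close>, viewed as a homogeneous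
  element of degree \<open>n\<close> of the direct sum of all pieces.
\<close>

definition gr_class ::
  "('k, 'a, 'm) module_scheme \<Rightarrow> (nat \<Rightarrow> 'a set) \<Rightarrow> nat \<Rightarrow> 'a \<Rightarrow> (nat \<Rightarrow> 'a set)"
  where "gr_class A F n x =
    (\<lambda>m. if m = n then filt_below A F n +>\<^bsub>A\<^esub> x else filt_below A F m)"

text \<open>The product \<open>F i / F (i - 1) \<times> F j / F (j - 1) \<rightarrow> F (i + j) / F (i + j - 1)\<close>.\<close>

definition gr_mult ::
  "('k, 'a, 'm) module_scheme \<Rightarrow> (nat \<Rightarrow> 'a set) \<Rightarrow> nat \<Rightarrow> nat \<Rightarrow> 'a set \<Rightarrow> 'a set \<Rightarrow> 'a set"
  where "gr_mult A F i j X Y =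
    (\<Union>x\<in>X. \<Union>y\<in>Y. filt_below A F (i + j) +>\<^bsub>A\<^esub> (x \<otimes>\<^bsub>A\<^esub> y))"

definition gr_alg ::
  "('k, 'a, 'm) module_scheme \<Rightarrow> (nat \<Rightarrow> 'a set) \<Rightarrow> ('k, nat \<Rightarrow> 'a set) module"
  where "gr_alg A F =
    \<lparr>carrier = carrier (sum_group UNIV (gr_piece A F)),
     monoid.mult = (\<lambda>g h n. finprod (gr_piece A F n) (\<lambda>i. gr_mult A F i (n - i) (g i) (h (n - i))) {..n}),
     one = gr_class A F 0 \<one>\<^bsub>A\<^esub>,
     zero = one (sum_group UNIV (gr_piece A F)),
     add = monoid.mult (sum_group UNIV (gr_piece A F)),
     smult = (\<lambda>c g n. \<Union>x\<in>g n. filt_below A F n +>\<^bsub>A\<^esub> (c \<odot>\<^bsub>A\<^esub> x))\<rparr>"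


section \<open>The tensor algebra of the space with basis \<open>e k\<close>, \<open>k\<close> an integer\<close>

text \<open>
  Words form a monoid under concatenation, so the finitely supported functions on words form a
  ring under convolution.
\<close>

instantiation list :: (type) monoid_add
begin
definition zero_list :: "'a list" where "zero_list = []"
definition plus_list :: "'a list \<Rightarrow> 'a list \<Rightarrow> 'a list" where "plus_list = (@)"
instance by standard (simp_all add: zero_list_def plus_list_def)
end

text \<open>
  The word \<open>[k\<^sub>1, \<dots>, k\<^sub>n]\<close> stands for the basis vector \<open>e k\<^sub>1 \<otimes> \<dots> \<otimes> e k\<^sub>n\<close> of the \<open>n\<close>-th tensor
  power of \<open>U\<close>; the product of \<open>T(U)\<close> is \<open>*\<close>, and \<open>U\<close> is its part of degree one.
\<close>

type_synonym tensor = "int list \<Rightarrow>\<^sub>0 complex"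

definition scale :: "complex \<Rightarrow> tensor \<Rightarrow> tensor"
  where "scale c x = Poly_Mapping.map ((*) c) x"

definition tensor_alg :: "(complex, tensor) module"
  where "tensor_alg =
    \<lparr>carrier = UNIV, monoid.mult = (*), one = 1, zero = 0, add = (+), smult = scale\<rparr>"

definition e :: "int \<Rightarrow> tensor"
  where "e k = Poly_Mapping.single [k] 1"

lemma e_mult_e: "e k * e l = Poly_Mapping.single [k, l] 1"
  by (simp add: e_def mult_single plus_list_def)

lemma lookup_scale: "Poly_Mapping.lookup (scale c x) w = c * Poly_Mapping.lookup x w"
  by (simp add: scale_def map.rep_eq when_def)

lemma module_scale: "Modules.module scale"
  by standard (auto intro!: poly_mapping_eqI simp: lookup_scale lookup_add algebra_simps)

lemma ring_tensor_alg: "Ring.ring tensor_alg"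
proof (rule ringI)
  show "abelian_group tensor_alg"
    by (rule abelian_groupI)
      (auto simp: tensor_alg_def algebra_simps intro: exI[of _ "- x" for x :: tensor]
        add.left_inverse)
  show "Group.monoid tensor_alg"
    by (rule monoidI) (auto simp: tensor_alg_def algebra_simps)
qed (auto simp: tensor_alg_def algebra_simps)

definition tensor_filt :: "nat \<Rightarrow> tensor set"
  where "tensor_filt n = {x. \<forall>w \<in> Poly_Mapping.keys x. length w \<le> n}"


section \<open>The enveloping algebra of the \<open>\<hbar>\<close>-Witt algebra\<close>

definition witt_exp :: "real \<Rightarrow> int \<Rightarrow> complex"
  where "witt_exp hbar k = exp (\<i> * of_int k * of_real hbar)"

definition quad_rel :: "real \<Rightarrow> int \<Rightarrow> int \<Rightarrow> tensor"
  where "quad_rel hbar k l = scale (witt_exp hbar k) (e k * e l) - scale (witt_exp hbar l) (e l * e k)"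

definition witt_rel :: "real \<Rightarrow> int \<Rightarrow> int \<Rightarrow> tensor"
  where "witt_rel hbar k l =
    scale (witt_exp hbar k) (e k * e l) - scale (witt_exp hbar l) (e l * e k)
      - scale ((witt_exp hbar l - witt_exp hbar k) / of_real hbar) (e (k + l))"

definition quad_space :: "real \<Rightarrow> tensor set"
  where "quad_space hbar = Modules.module.span scale {quad_rel hbar k l | k l. True}"

text \<open>\<^const>\<open>genideal\<close> generates two-sided ideals.\<close>

definition quad_ideal :: "real \<Rightarrow> tensor set"
  where "quad_ideal hbar = Idl\<^bsub>tensor_alg\<^esub> (quad_space hbar)"

definition witt_ideal :: "real \<Rightarrow> tensor set"
  where "witt_ideal hbar = Idl\<^bsub>tensor_alg\<^esub> {witt_rel hbar k l | k l. True}"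

definition quad_alg :: "real \<Rightarrow> (complex, tensor set) module"
  where "quad_alg hbar = quot_alg tensor_alg (quad_ideal hbar)"

definition witt_alg :: "real \<Rightarrow> (complex, tensor set) module"
  where "witt_alg hbar = quot_alg tensor_alg (witt_ideal hbar)"

definition witt_filt :: "real \<Rightarrow> nat \<Rightarrow> tensor set set"
  where "witt_filt hbar n = (\<lambda>x. witt_ideal hbar +>\<^bsub>tensor_alg\<^esub> x) ` tensor_filt n"

definition gr_witt :: "real \<Rightarrow> (complex, nat \<Rightarrow> tensor set set) module"
  where "gr_witt hbar = gr_alg (witt_alg hbar) (witt_filt hbar)"

text \<open>
  As the \<open>e k\<close> generate \<open>T(U)\<close>, their images determine the canonical homomorphism on the carrier
  of \<^term>\<open>quad_alg hbar\<close>.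
\<close>

definition is_canonical_hom :: "real \<Rightarrow> (tensor set \<Rightarrow> (nat \<Rightarrow> tensor set set)) \<Rightarrow> bool"
  where "is_canonical_hom hbar \<phi> \<longleftrightarrow>
    \<phi> \<in> alg_hom (quad_alg hbar) (gr_witt hbar) \<and>
    (\<forall>k. \<phi> (quad_ideal hbar +>\<^bsub>tensor_alg\<^esub> e k) =
      gr_class (witt_alg hbar) (witt_filt hbar) 1 (witt_ideal hbar +>\<^bsub>tensor_alg\<^esub> e k))"

end

(*
  The relations of the hbar-Witt algebra do not satisfy the diamond condition: reordering
  e_1 e_2 e_4 into multiples of e_4 e_2 e_1 plus lower terms in the two possible ways gives two
  results whose difference d lies in the ideal of relations. The cubic terms cancel and no linear
  terms occur, so d is homogeneous of degree two; hence the canonical homomorphism kills the class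
  of d. But d is nonzero modulo the quadratic relations: these relate only words that are
  permutations of each other, and the e_1, e_6 part of d is a nonzero multiple of
  q^4 e_6 e_1 - e_1 e_6, while the quadratic relation is e_1 e_6 = q^5 e_6 e_1.
*)
theory Submission
  imports Defs
begin

section \<open>Homogeneous components in the tensor algebra\<close>

definition hom_part :: "nat \<Rightarrow> tensor \<Rightarrow> tensor"
  where "hom_part n x = Poly_Mapping.mapp (\<lambda>w c. c when length w = n) x"

text \<open>The strict bound makes degree \<open>0\<close> yield \<open>{0}\<close>, which matches
  the convention F(-1) = 0 of \<open>filt_below\<close> without a truncated subtraction.\<close>

definition tensor_below :: "nat \<Rightarrow> tensor set"
  where "tensor_below n = {x. \<forall>w \<in> Poly_Mapping.keys x. length w < n}"

lemma lookup_hom_part: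
  "Poly_Mapping.lookup (hom_part n x) w = (Poly_Mapping.lookup x w when length w = n)"
  by (simp add: hom_part_def lookup_mapp when_def in_keys_iff)

lemma hom_part_add: "hom_part n (x + y) = hom_part n x + hom_part n y"
  by (rule poly_mapping_eqI) (simp add: lookup_hom_part lookup_add when_def)

lemma hom_part_diff: "hom_part n (x - y) = hom_part n x - hom_part n y"
  by (rule poly_mapping_eqI) (simp add: lookup_hom_part lookup_minus when_def)

lemma hom_part_zero [simp]: "hom_part n 0 = 0"
  by (rule poly_mapping_eqI) (simp add: lookup_hom_part)

lemma hom_part_scale: "hom_part n (scale c x) = scale c (hom_part n x)"
  by (rule poly_mapping_eqI) (simp add: lookup_hom_part lookup_scale when_def)

lemma hom_part_sum: "hom_part n (sum f S) = (\<Sum>i\<in>S. hom_part n (f i))"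
  by (induction S rule: infinite_finite_induct) (simp_all add: hom_part_add)

lemma hom_part_single:
  "hom_part n (Poly_Mapping.single w c) = (if length w = n then Poly_Mapping.single w c else 0)"
  by (rule poly_mapping_eqI) (simp add: lookup_hom_part lookup_single when_def)

lemma single_Nil_one: "Poly_Mapping.single [] 1 = (1 :: tensor)"
  unfolding zero_list_def[symmetric] by (rule single_one)

lemma hom_part_hom_part: "hom_part m (hom_part n x) = (if m = n then hom_part n x else 0)"
  by (rule poly_mapping_eqI) (simp add: lookup_hom_part when_def)

section \<open>The degree filtration of the tensor algebra\<close>

lemma mem_tensor_filt_iff:
  "x \<in> tensor_filt n \<longleftrightarrow> (\<forall>w. n < length w \<longrightarrow> Poly_Mapping.lookup x w = 0)"
  by (force simp: tensor_filt_def in_keys_iff not_le)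

lemma mem_tensor_below_iff:
  "x \<in> tensor_below n \<longleftrightarrow> (\<forall>w. n \<le> length w \<longrightarrow> Poly_Mapping.lookup x w = 0)"
  by (force simp: tensor_below_def in_keys_iff not_le)

lemma tensor_below_0: "tensor_below 0 = {0}"
  by (auto simp: mem_tensor_below_iff intro: poly_mapping_eqI)

lemma tensor_below_Suc: "tensor_below (Suc n) = tensor_filt n"
  by (auto simp: mem_tensor_below_iff mem_tensor_filt_iff Suc_le_eq)

lemma tensor_below_subset_filt: "tensor_below n \<subseteq> tensor_filt n"
  by (auto simp: mem_tensor_below_iff mem_tensor_filt_iff)

lemma zero_in_tensor_below [simp]: "0 \<in> tensor_below n"
  by (simp add: mem_tensor_below_iff)

lemma zero_in_tensor_filt [simp]: "0 \<in> tensor_filt n"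
  by (simp add: mem_tensor_filt_iff)

lemma tensor_below_add: "x \<in> tensor_below n \<Longrightarrow> y \<in> tensor_below n \<Longrightarrow> x + y \<in> tensor_below n"
  by (simp add: mem_tensor_below_iff lookup_add)

lemma tensor_below_diff: "x \<in> tensor_below n \<Longrightarrow> y \<in> tensor_below n \<Longrightarrow> x - y \<in> tensor_below n"
  by (simp add: mem_tensor_below_iff lookup_minus)

lemma tensor_below_scale: "x \<in> tensor_below n \<Longrightarrow> scale c x \<in> tensor_below n"
  by (simp add: mem_tensor_below_iff lookup_scale)

lemma tensor_filt_add: "x \<in> tensor_filt n \<Longrightarrow> y \<in> tensor_filt n \<Longrightarrow> x + y \<in> tensor_filt n"
  by (simp add: mem_tensor_filt_iff lookup_add)

lemma tensor_filt_diff: "x \<in> tensor_filt n \<Longrightarrow> y \<in> tensor_filt n \<Longrightarrow> x - y \<in> tensor_filt n"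
  by (simp add: mem_tensor_filt_iff lookup_minus)

lemma hom_part_in_filt: "hom_part n x \<in> tensor_filt n"
  by (simp add: mem_tensor_filt_iff lookup_hom_part)

lemma diff_hom_part_in_below: "x \<in> tensor_filt n \<Longrightarrow> x - hom_part n x \<in> tensor_below n"
  by (simp add: mem_tensor_filt_iff mem_tensor_below_iff lookup_minus lookup_hom_part when_def)

lemma tensor_filt_mult:
  assumes "x \<in> tensor_filt m" "y \<in> tensor_filt n"
  shows "x * y \<in> tensor_filt (m + n)"
proof -
  have "length w \<le> m + n" if w: "w \<in> Poly_Mapping.keys (x * y)" for w
  proof -
    obtain u v where "w = u + v" "u \<in> Poly_Mapping.keys x" "v \<in> Poly_Mapping.keys y"
      using w keys_mult[of x y] by blast
    then show ?thesis using assms by (auto simp: plus_list_def tensor_filt_def intro: add_mono)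
  qed
  then show ?thesis by (simp add: tensor_filt_def)
qed

lemma tensor_below_mult_left:
  assumes "x \<in> tensor_filt m" "y \<in> tensor_below n"
  shows "x * y \<in> tensor_below (m + n)"
  using assms tensor_filt_mult[of x m y "n - 1"]
  by (cases n) (auto simp: tensor_below_0 tensor_below_Suc)

lemma tensor_below_mult_right:
  assumes "x \<in> tensor_below m" "y \<in> tensor_filt n"
  shows "x * y \<in> tensor_below (m + n)"
  using assms tensor_filt_mult[of x "m - 1" y n]
  by (cases m) (auto simp: tensor_below_0 tensor_below_Suc)

text \<open>Updating at a key outside the support adds a monomial, so additive statements about
  tensors only have to be checked on monomials.\<close>

lemma tensor_induct [case_names single add]:
  fixes x :: tensor
  assumes single: "\<And>w c. P (Poly_Mapping.single w c)"
    and add: "\<And>x y. P x \<Longrightarrow> P y \<Longrightarrow> P (x + y)"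
  shows "P x"
proof (induction x rule: update_induct)
  case const
  \<comment> \<open>The zero tensor counts as a monomial with coefficient \<open>0\<close>.\<close>
  show ?case using single[of "[]" 0] by simp
next
  case (update f a b)
  have "Poly_Mapping.update a b f = f + Poly_Mapping.single a b"
    using update(1) by (intro poly_mapping_eqI)
      (auto simp: lookup_update lookup_add lookup_single when_def in_keys_iff)
  then show ?case using add[OF update(3) single] by simp
qed

text \<open>Both sides are additive in \<open>x\<close> and in \<open>y\<close>. For monomials only
  the summand with \<open>i = length u\<close> survives, because lengths add under
  concatenation.\<close>

lemma hom_part_mult: "hom_part n (x * y) = (\<Sum>i\<le>n. hom_part i x * hom_part (n - i) y)"
proof (induction x rule: tensor_induct)
  case (single u a)
  show ?case
  proof (induction y rule: tensor_induct)
    case (single v b)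
    have "(\<Sum>i\<le>n. hom_part i (Poly_Mapping.single u a) * hom_part (n - i) (Poly_Mapping.single v b))
      = (\<Sum>i\<le>n. if i = length u then
          Poly_Mapping.single u a * hom_part (n - i) (Poly_Mapping.single v b) else 0)"
      by (intro sum.cong) (auto simp: hom_part_single)
    also have "\<dots> = hom_part n (Poly_Mapping.single u a * Poly_Mapping.single v b)"
      by (auto simp: hom_part_single mult_single plus_list_def)
    finally show ?case by simp
  qed (simp add: hom_part_add algebra_simps sum.distrib)
qed (simp add: hom_part_add algebra_simps sum.distrib)

lemma tensor_filt_exhaust: obtains n where "x \<in> tensor_filt n"
proof
  \<comment> \<open>The sum of all word lengths is a crude degree bound that also covers empty
    support.\<close>
  show "x \<in> tensor_filt (\<Sum>w\<in>Poly_Mapping.keys x. length w)"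
    by (auto simp: tensor_filt_def intro: member_le_sum)
qed

text \<open>Scalars become constants, i.e. monomials on the empty word. Closure under scalars then
  follows from the ideal property; together with the right-hand version below, constants are
  central.\<close>

lemma scale_conv_mult: "scale c x = Poly_Mapping.single [] c * x"
proof (induction x rule: tensor_induct)
  case (single w d)
  show ?case
    by (rule poly_mapping_eqI)
      (simp add: mult_single plus_list_def lookup_scale lookup_single when_def)
next
  case (add x y)
  then show ?case
    by (simp add: module.scale_right_distrib[OF module_scale] distrib_left distrib_right)
qed

lemma hom_part_0: "hom_part 0 x = Poly_Mapping.single [] (Poly_Mapping.lookup x [])"
  by (rule poly_mapping_eqI) (simp add: lookup_hom_part lookup_single when_def)

lemma scale_conv_mult_right: "scale c x = x * Poly_Mapping.single [] c"
proof (induction x rule: tensor_induct)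
  case (single w d)
  show ?case
    by (rule poly_mapping_eqI)
      (simp add: mult_single plus_list_def lookup_scale lookup_single when_def)
next
  case (add x y)
  then show ?case
    by (simp add: module.scale_right_distrib[OF module_scale] distrib_left distrib_right)
qed

section \<open>Two-sided ideals and their cosets\<close>

lemma tensor_alg_simps [simp]:
  "carrier tensor_alg = UNIV" "monoid.mult tensor_alg = (*)" "one tensor_alg = 1"
  "zero tensor_alg = 0" "add tensor_alg = (+)" "smult tensor_alg = scale"
  by (simp_all add: tensor_alg_def)

lemma ideal_tensor_algI:
  assumes "0 \<in> J" "\<And>x y. x \<in> J \<Longrightarrow> y \<in> J \<Longrightarrow> x + y \<in> J"
    and "\<And>x y. x \<in> J \<Longrightarrow> y * x \<in> J" "\<And>x y. x \<in> J \<Longrightarrow> x * y \<in> J"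
  shows "ideal J tensor_alg"
proof (rule idealI)
  interpret R: Ring.ring tensor_alg by (rule ring_tensor_alg)
  show "subgroup J (add_monoid tensor_alg)"
  proof (rule R.add.subgroupI)
    show "J \<noteq> {}" using assms(1) by blast
    fix x assume x: "x \<in> J"
    \<comment> \<open>Negation is multiplication by \<open>- 1\<close>, so closure under negatives
      follows from absorption.\<close>
    have "\<ominus>\<^bsub>tensor_alg\<^esub> x = (- 1) * x"
      by (rule R.minus_equality) auto
    then show "\<ominus>\<^bsub>tensor_alg\<^esub> x \<in> J"
      using assms(3)[OF x] by metis
  qed (use assms in auto)
qed (use assms ring_tensor_alg in auto)

text \<open>Developed once for an arbitrary ideal and interpreted twice: as \<open>Q\<close> for the
  quadratic relations and as \<open>W\<close> for the Witt relations.\<close>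

locale tensor_ideal =
  fixes J :: "tensor set"
  assumes is_ideal: "ideal J tensor_alg"
begin

lemma zero_mem [simp]: "0 \<in> J"
  using additive_subgroup.zero_closed[OF ideal.axioms(1)[OF is_ideal]] by simp

lemma add_mem: "x \<in> J \<Longrightarrow> y \<in> J \<Longrightarrow> x + y \<in> J"
  using additive_subgroup.a_closed[OF ideal.axioms(1)[OF is_ideal], of x y] by simp

lemma mult_mem_left: "x \<in> J \<Longrightarrow> y * x \<in> J"
  using ideal.I_l_closed[OF is_ideal, of x y] by simp

lemma mult_mem_right: "x \<in> J \<Longrightarrow> x * y \<in> J"
  using ideal.I_r_closed[OF is_ideal, of x y] by simp

lemma scale_mem: "x \<in> J \<Longrightarrow> scale c x \<in> J"
  by (simp add: scale_conv_mult mult_mem_left)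

lemma uminus_mem: "x \<in> J \<Longrightarrow> - x \<in> J"
  using mult_mem_left[of x "- 1"] by simp

lemma diff_mem: "x \<in> J \<Longrightarrow> y \<in> J \<Longrightarrow> x - y \<in> J"
  using add_mem[of x "- y"] uminus_mem[of y] by simp

abbreviation A where "A \<equiv> quot_alg tensor_alg J"

abbreviation proj where "proj x \<equiv> J +>\<^bsub>tensor_alg\<^esub> x"

lemma mem_proj_iff: "y \<in> proj x \<longleftrightarrow> y - x \<in> J"
  by (force simp: a_r_coset_def' algebra_simps)

lemma proj_eq_iff: "proj x = proj y \<longleftrightarrow> x - y \<in> J"
proof
  assume "proj x = proj y"
  then show "x - y \<in> J" by (metis mem_proj_iff diff_self zero_mem)
next
  assume *: "x - y \<in> J"
  have "z - x \<in> J \<longleftrightarrow> z - y \<in> J" for z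
    using add_mem[OF _ *, of "z - x"] diff_mem[OF _ *, of "z - y"] by auto
  then show "proj x = proj y" by (auto simp: mem_proj_iff)
qed

lemma carrier_A: "carrier A = range proj"
  by (auto simp: quot_alg_def ring.extend_def FactRing_def A_RCOSETS_def' a_r_coset_def')

lemma add_A: "add A (proj x) (proj y) = proj (x + y)"
proof -
  interpret ideal J tensor_alg by (rule is_ideal)
  show ?thesis using a_rcos_sum[of x y] by (simp add: quot_alg_def ring.extend_def FactRing_def)
qed

lemma mult_A: "monoid.mult A (proj x) (proj y) = proj (x * y)"
  using ideal.rcoset_mult_add[OF is_ideal, of x y] by (simp add: quot_alg_def ring.extend_def FactRing_def)

lemma one_A: "one A = proj 1"
  by (simp add: quot_alg_def ring.extend_def FactRing_def)

lemma zero_A: "zero A = proj 0"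
  by (auto simp: quot_alg_def ring.extend_def FactRing_def mem_proj_iff)

lemma smult_A: "smult A c (proj x) = proj (scale c x)"
proof -
  \<comment> \<open>The definition of \<open>quot_alg\<close> takes a union over all
    representatives; since they all give the same coset, the union collapses.\<close>
  have "proj (scale c y) = proj (scale c x)" if "y \<in> proj x" for y
    using scale_mem[of "y - x" c] that
    by (simp add: mem_proj_iff proj_eq_iff scale_conv_mult algebra_simps)
  moreover have "x \<in> proj x" by (simp add: mem_proj_iff)
  ultimately have "(\<Union>y\<in>proj x. proj (scale c y)) = proj (scale c x)"
    by blast
  then show ?thesis
    by (simp add: quot_alg_def ring.extend_def module.defs FactRing_def)
qed

text \<open>This is J + T(U) in degrees below \<open>n\<close>, the preimage in T(U) of the
  filtration step F(n - 1) of the quotient. Vanishing in the graded piece of degree \<open>n\<close>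
  thus becomes a condition on tensors.\<close>

definition low_part :: "nat \<Rightarrow> tensor set"
  where "low_part n = {z. \<exists>u\<in>tensor_below n. z - u \<in> J}"

lemma low_part_add: "x \<in> low_part n \<Longrightarrow> y \<in> low_part n \<Longrightarrow> x + y \<in> low_part n"
proof -
  assume "x \<in> low_part n" "y \<in> low_part n"
  then obtain u v where "u \<in> tensor_below n" "x - u \<in> J" "v \<in> tensor_below n" "y - v \<in> J"
    by (auto simp: low_part_def)
  then have "u + v \<in> tensor_below n" "(x + y) - (u + v) \<in> J"
    using add_mem[of "x - u" "y - v"] by (simp_all add: tensor_below_add algebra_simps)
  then show ?thesis by (auto simp: low_part_def)
qed

lemma low_part_diff: "x \<in> low_part n \<Longrightarrow> y \<in> low_part n \<Longrightarrow> x - y \<in> low_part n"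
proof -
  assume "x \<in> low_part n" "y \<in> low_part n"
  then obtain u v where "u \<in> tensor_below n" "x - u \<in> J" "v \<in> tensor_below n" "y - v \<in> J"
    by (auto simp: low_part_def)
  then have "u - v \<in> tensor_below n" "(x - y) - (u - v) \<in> J"
    using diff_mem[of "x - u" "y - v"] by (simp_all add: tensor_below_diff algebra_simps)
  then show ?thesis by (auto simp: low_part_def)
qed

lemma low_part_of_below: "x \<in> tensor_below n \<Longrightarrow> x \<in> low_part n"
  by (force simp: low_part_def)

lemma low_part_of_mem: "x \<in> J \<Longrightarrow> x \<in> low_part n"
  by (force simp: low_part_def intro: bexI[of _ 0])

lemma low_part_mult_left:
  assumes "x \<in> low_part n" "y \<in> tensor_filt m"
  shows "y * x \<in> low_part (m + n)"
proof -
  obtain u where "u \<in> tensor_below n" "x - u \<in> J" using assms by (auto simp: low_part_def)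
  then have "y * u \<in> tensor_below (m + n)" "y * x - y * u \<in> J"
    using mult_mem_left[of "x - u" y] assms(2) by (simp_all add: tensor_below_mult_left right_diff_distrib)
  then show ?thesis by (auto simp: low_part_def)
qed

lemma low_part_mult_right:
  assumes "x \<in> low_part n" "y \<in> tensor_filt m"
  shows "x * y \<in> low_part (n + m)"
proof -
  obtain u where "u \<in> tensor_below n" "x - u \<in> J" using assms by (auto simp: low_part_def)
  then have "u * y \<in> tensor_below (n + m)" "x * y - u * y \<in> J"
    using mult_mem_right[of "x - u" y] assms(2) by (simp_all add: tensor_below_mult_right left_diff_distrib)
  then show ?thesis by (auto simp: low_part_def)
qed

lemma low_part_sum: "(\<And>i. i \<in> S \<Longrightarrow> f i \<in> low_part n) \<Longrightarrow> sum f S \<in> low_part n"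
  by (induction S rule: infinite_finite_induct) (auto simp: low_part_add low_part_of_mem)

subsection \<open>The associated graded algebra of the quotient\<close>

abbreviation filt where "filt n \<equiv> proj ` tensor_filt n"

abbreviation piece where "piece n \<equiv> gr_piece A filt n"

text \<open>For \<open>x\<close> in \<open>tensor_filt n\<close> this is the class of
  \<open>proj x\<close> in F(n) / F(n - 1), a set of cosets of \<open>J\<close>;
  \<open>cls n 0\<close> is F(n - 1) itself.\<close>

definition cls :: "nat \<Rightarrow> tensor \<Rightarrow> tensor set set"
  where "cls n x = proj ` {y. y - x \<in> tensor_below n}"

text \<open>The canonical homomorphism lifted to T(U): in degree \<open>n\<close> it records the
  class of the component of degree \<open>n\<close>.\<close>

definition gr_map :: "tensor \<Rightarrow> nat \<Rightarrow> tensor set set"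
  where "gr_map x n = cls n (hom_part n x)"

lemma cls_eq_iff: "cls n x = cls n y \<longleftrightarrow> x - y \<in> low_part n"
proof
  assume "cls n x = cls n y"
  moreover have "proj x \<in> cls n x" unfolding cls_def by (rule imageI) simp
  ultimately have "proj x \<in> cls n y" by simp
  then obtain z where "z - y \<in> tensor_below n" "x - z \<in> J"
    by (auto simp: cls_def proj_eq_iff)
  then show "x - y \<in> low_part n"
    by (auto simp: low_part_def intro!: bexI[of _ "z - y"])
next
  have *: "cls n x \<subseteq> cls n y" if xy: "x - y \<in> low_part n" for x y
  proof
    fix X assume "X \<in> cls n x"
    then obtain z where z: "X = proj z" "z - x \<in> tensor_below n" by (auto simp: cls_def)
    obtain u where u: "u \<in> tensor_below n" "x - y - u \<in> J"
      using xy by (auto simp: low_part_def)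
    \<comment> \<open>The representative is moved from the class of \<open>x\<close> to that of
      \<open>y\<close>: the new one differs from \<open>z\<close> by \<open>x - y - u\<close>, which
      lies in \<open>J\<close>.\<close>
    have "(z - x + y + u) - y \<in> tensor_below n"
      using tensor_below_add[OF z(2) u(1)] by (simp add: algebra_simps)
    moreover have "X = proj (z - x + y + u)"
      using u z by (simp add: proj_eq_iff algebra_simps)
    ultimately show "X \<in> cls n y" by (auto simp: cls_def)
  qed
  assume "x - y \<in> low_part n"
  moreover from this have "y - x \<in> low_part n"
    using low_part_diff[of 0 n "x - y"] by (simp add: low_part_of_below)
  ultimately show "cls n x = cls n y" using * by blast
qed

lemma filt_below_A: "filt_below A filt n = cls n 0"
proof (cases n)
  case 0
  then show ?thesis
    using tensor_below_0 by (simp add: filt_below_def cls_def zero_A)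
next
  case (Suc m)
  then show ?thesis
    by (simp add: filt_below_def cls_def tensor_below_Suc)
qed

lemma filt_below_coset: "filt_below A filt n +>\<^bsub>A\<^esub> proj x = cls n x"
proof -
  have "{y. y - x \<in> tensor_below n} = (\<lambda>u. u + x) ` tensor_below n"
    by (auto intro: image_eqI[where x = "y - x" for y])
  moreover have "filt_below A filt n = proj ` tensor_below n"
    by (simp add: filt_below_A cls_def)
  ultimately show ?thesis
    by (simp add: cls_def a_r_coset_def[of A] r_coset_def[of "add_monoid A"] add_A image_image UNION_singleton_eq_range)
qed

lemma mem_cls: "X \<in> cls n x \<Longrightarrow> \<exists>y. X = proj y \<and> y - x \<in> tensor_below n"
  by (auto simp: cls_def)

lemma proj_mem_cls: "proj x \<in> cls n x"
  unfolding cls_def by (rule imageI) simp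

lemma cls_cong_below: "y - x \<in> tensor_below n \<Longrightarrow> cls n y = cls n x"
  by (simp add: cls_eq_iff low_part_of_below)

section \<open>The graded pieces and their products\<close>

lemma carrier_piece: "carrier (piece n) = cls n ` tensor_filt n"
  by (auto simp: gr_piece_def carrier_FactGroup r_coset_def
      filt_below_coset[symmetric] a_r_coset_def)

lemma one_piece: "one (piece n) = cls n 0"
  by (simp add: gr_piece_def filt_below_A)

lemma mult_piece: "monoid.mult (piece n) (cls n x) (cls n y) = cls n (x + y)"
proof -
  have "add A X Y \<in> cls n (x + y)" if X: "X \<in> cls n x" and Y: "Y \<in> cls n y" for X Y
  proof -
    obtain a b where "X = proj a" "a - x \<in> tensor_below n" "Y = proj b" "b - y \<in> tensor_below n"
      using mem_cls[OF X] mem_cls[OF Y] by blast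
    then show ?thesis
      using tensor_below_add[of "a - x" n "b - y"]
      by (auto simp: add_A cls_def algebra_simps)
  qed
  moreover have "\<exists>X\<in>cls n x. \<exists>Y\<in>cls n y. Z = add A X Y" if Z: "Z \<in> cls n (x + y)" for Z
  proof -
    obtain a where a: "Z = proj a" "a - (x + y) \<in> tensor_below n"
      using mem_cls[OF Z] by blast
    then have "Z = add A (proj (a - y)) (proj y)" "proj (a - y) \<in> cls n x"
      by (auto simp: add_A cls_def algebra_simps)
    then show ?thesis using proj_mem_cls by blast
  qed
  ultimately show ?thesis
    by (auto simp: gr_piece_def set_mult_def)
qed

lemma comm_group_piece: "comm_group (piece n)"
proof (rule comm_groupI)
  show "\<exists>y\<in>carrier (piece n). y \<otimes>\<^bsub>piece n\<^esub> x = \<one>\<^bsub>piece n\<^esub>" if x: "x \<in> carrier (piece n)" for x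
  proof -
    obtain a where "a \<in> tensor_filt n" "x = cls n a" using x by (auto simp: carrier_piece)
    moreover from this have "0 - a \<in> tensor_filt n" by (intro tensor_filt_diff) simp_all
    ultimately show ?thesis
      by (auto simp: carrier_piece one_piece mult_piece intro!: bexI[of _ "- a"])
  qed
qed (auto simp: carrier_piece one_piece mult_piece tensor_filt_add algebra_simps)

lemma group_piece: "group (piece n)"
  using comm_group_piece by (rule comm_group.axioms)

lemma finprod_piece:
  assumes "finite S" "\<And>i. i \<in> S \<Longrightarrow> f i \<in> tensor_filt n"
  shows "finprod (piece n) (\<lambda>i. cls n (f i)) S = cls n (sum f S)"
proof -
  interpret comm_group "piece n" by (rule comm_group_piece)
  show ?thesis
    using assms
    by (induction S rule: finite_induct)
      (simp_all add: one_piece mult_piece carrier_piece Pi_iff)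
qed

lemma gr_mult_cls:
  assumes x: "x \<in> tensor_filt i" and y: "y \<in> tensor_filt j"
  shows "gr_mult A filt i j (cls i x) (cls j y) = cls (i + j) (x * y)"
proof -
  have "filt_below A filt (i + j) +>\<^bsub>A\<^esub> (X \<otimes>\<^bsub>A\<^esub> Y) = cls (i + j) (x * y)"
    if X: "X \<in> cls i x" and Y: "Y \<in> cls j y" for X Y
  proof -
    obtain a b where a: "X = proj a" "a - x \<in> tensor_below i"
      and b: "Y = proj b" "b - y \<in> tensor_below j"
      using mem_cls[OF X] mem_cls[OF Y] by blast
    have "b \<in> tensor_filt j"
      using tensor_filt_add[OF y, of "b - y"] b(2) tensor_below_subset_filt by auto
    \<comment> \<open>This sum is \<open>a * b - x * y\<close>; each summand has one factor of too
      low degree, so the product class does not depend on the representatives.\<close>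
    then have "(a - x) * b + x * (b - y) \<in> tensor_below (i + j)"
      by (intro tensor_below_add tensor_below_mult_left tensor_below_mult_right a b x)
    then show ?thesis
      by (simp add: a b mult_A filt_below_coset cls_cong_below algebra_simps)
  qed
  then show ?thesis
    using proj_mem_cls unfolding gr_mult_def by blast
qed

section \<open>The map from the tensor algebra onto the graded algebra\<close>

lemma carrier_gr: "carrier (gr_alg A filt) =
    {g. (\<forall>n. g n \<in> cls n ` tensor_filt n) \<and> finite {n. g n \<noteq> cls n 0}}"
  by (auto simp: gr_alg_def carrier_sum_group group_piece carrier_piece one_piece PiE_iff)

lemma gr_map_eq_iff: "gr_map x = gr_map y \<longleftrightarrow> (\<forall>n. hom_part n (x - y) \<in> low_part n)"
  by (auto simp: gr_map_def fun_eq_iff cls_eq_iff hom_part_diff)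

lemma gr_map_in_carrier: "gr_map x \<in> carrier (gr_alg A filt)"
proof -
  obtain m where m: "x \<in> tensor_filt m" by (rule tensor_filt_exhaust)
  have "hom_part n x = 0" if "n > m" for n
    using m that
    by (intro poly_mapping_eqI) (simp add: lookup_hom_part mem_tensor_filt_iff when_def)
  then have "{n. gr_map x n \<noteq> cls n 0} \<subseteq> {..m}"
    by (auto simp: gr_map_def not_le[symmetric])
  then show ?thesis
    using finite_subset by (auto simp: carrier_gr gr_map_def hom_part_in_filt)
qed

lemma gr_map_add: "add (gr_alg A filt) (gr_map x) (gr_map y) = gr_map (x + y)"
  by (simp add: gr_alg_def gr_map_def mult_piece hom_part_add fun_eq_iff)

text \<open>The product in \<open>gr_alg\<close> is a convolution over degrees, just as
  \<open>hom_part_mult\<close> expresses components of a product in T(U).\<close>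

lemma gr_map_mult: "monoid.mult (gr_alg A filt) (gr_map x) (gr_map y) = gr_map (x * y)"
proof
  fix n
  interpret comm_group "piece n" by (rule comm_group_piece)
  have filt: "hom_part i x * hom_part (n - i) y \<in> tensor_filt n" if "i \<le> n" for i
    using tensor_filt_mult[OF hom_part_in_filt[of i x] hom_part_in_filt[of "n - i" y]] that by simp
  have "finprod (piece n) (\<lambda>i. gr_mult A filt i (n - i) (gr_map x i) (gr_map y (n - i))) {..n}
    = finprod (piece n) (\<lambda>i. cls n (hom_part i x * hom_part (n - i) y)) {..n}"
    using filt gr_mult_cls[OF hom_part_in_filt[of _ x] hom_part_in_filt[of "n - _" y]]
    by (intro finprod_cong') (auto simp: gr_map_def carrier_piece)
  also have "\<dots> = gr_map (x * y) n"
    using finprod_piece[of "{..n}" "\<lambda>i. hom_part i x * hom_part (n - i) y" n] filt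
    by (simp add: hom_part_mult gr_map_def)
  finally show "monoid.mult (gr_alg A filt) (gr_map x) (gr_map y) n = gr_map (x * y) n"
    by (simp add: gr_alg_def)
qed

lemma gr_map_smult: "smult (gr_alg A filt) c (gr_map x) = gr_map (scale c x)"
proof
  fix n
  have "filt_below A filt n +>\<^bsub>A\<^esub> (c \<odot>\<^bsub>A\<^esub> X) = gr_map (scale c x) n" if X: "X \<in> gr_map x n" for X
  proof -
    obtain a where a: "X = proj a" "a - hom_part n x \<in> tensor_below n"
      using mem_cls[OF X[unfolded gr_map_def]] by blast
    then have "scale c a - scale c (hom_part n x) \<in> tensor_below n"
      using tensor_below_scale[OF a(2), of c] by (simp add: scale_conv_mult algebra_simps)
    then show ?thesis
      by (simp add: a(1) smult_A filt_below_coset gr_map_def cls_cong_below hom_part_scale)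
  qed
  moreover have "gr_map x n \<noteq> {}" using proj_mem_cls unfolding gr_map_def by blast
  ultimately show "smult (gr_alg A filt) c (gr_map x) n = gr_map (scale c x) n"
    by (simp add: gr_alg_def)
qed

lemma gr_class_homogeneous:
  assumes "hom_part n x = x"
  shows "gr_class A filt n (proj x) = gr_map x"
proof -
  have "hom_part m x = (if m = n then x else 0)" for m
    using hom_part_hom_part[of m n x] unfolding assms .
  then show ?thesis
    by (simp add: gr_class_def fun_eq_iff filt_below_coset gr_map_def) (simp add: filt_below_A)
qed

lemma gr_map_one: "one (gr_alg A filt) = gr_map 1"
proof -
  have "hom_part 0 1 = 1" using hom_part_single[of 0 "[]" 1] unfolding single_Nil_one by simp
  then have "gr_class A filt 0 (proj 1) = gr_map 1" by (rule gr_class_homogeneous)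
  then show ?thesis by (simp add: gr_alg_def one_A)
qed

lemma range_gr_map: "range gr_map = carrier (gr_alg A filt)"
proof
  show "range gr_map \<subseteq> carrier (gr_alg A filt)" using gr_map_in_carrier by blast
  show "carrier (gr_alg A filt) \<subseteq> range gr_map"
  proof
    fix g assume g: "g \<in> carrier (gr_alg A filt)"
    then have "\<forall>n. \<exists>x. x \<in> tensor_filt n \<and> g n = cls n x" by (auto simp: carrier_gr)
    then obtain f where f: "\<And>n. f n \<in> tensor_filt n" "\<And>n. g n = cls n (f n)" by metis
    define S where "S = {n. g n \<noteq> cls n 0}"
    have S: "finite S" using g by (simp add: S_def carrier_gr)
    \<comment> \<open>Lower components of \<open>f n\<close> do not affect its class. Keeping only
      the top ones prevents interference between degrees, and finite support makes the sum a
      tensor.\<close>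
    define x where "x = (\<Sum>n\<in>S. hom_part n (f n))"
    have "gr_map x n = g n" for n
    proof -
      have "hom_part n x = (\<Sum>m\<in>S. if m = n then hom_part n (f n) else 0)"
        unfolding x_def hom_part_sum by (rule sum.cong) (auto simp: hom_part_hom_part)
      also have "\<dots> = (if n \<in> S then hom_part n (f n) else 0)"
        using S by simp
      finally have *: "hom_part n x = (if n \<in> S then hom_part n (f n) else 0)" .
      have "f n - hom_part n (f n) \<in> tensor_below n" by (rule diff_hom_part_in_below[OF f(1)])
      then show ?thesis using * cls_cong_below[of "f n" "hom_part n (f n)" n] f(2)[of n]
        by (auto simp: gr_map_def S_def)
    qed
    then show "g \<in> range gr_map" by (intro range_eqI[of _ _ x]) (auto simp: fun_eq_iff)
  qed
qed

text \<open>Each component of a product is a sum of products of components, and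
  \<open>low_part\<close> absorbs multiplication by filtered elements with the right shift of
  degree. Hence an ideal lies in the kernel as soon as its generators do.\<close>

lemma ideal_gr_map_kernel: "ideal {x. gr_map x = gr_map 0} tensor_alg"
proof -
  have ker: "{x. gr_map x = gr_map 0} = {x. \<forall>n. hom_part n x \<in> low_part n}"
    by (simp add: gr_map_eq_iff)
  have le: "hom_part i u * hom_part (n - i) v \<in> low_part n"
    if "i \<le> n" "hom_part i u \<in> low_part i \<or> hom_part (n - i) v \<in> low_part (n - i)" for i n u v
    using that low_part_mult_left[OF _ hom_part_in_filt, of "hom_part (n - i) v" "n - i" i u]
      low_part_mult_right[OF _ hom_part_in_filt, of "hom_part i u" i "n - i" v] by auto
  have "hom_part n (y * x) \<in> low_part n" if "\<forall>n. hom_part n x \<in> low_part n" for x y n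
    unfolding hom_part_mult using that by (intro low_part_sum le) auto
  moreover have "hom_part n (x * y) \<in> low_part n" if "\<forall>n. hom_part n x \<in> low_part n" for x y n
    unfolding hom_part_mult using that by (intro low_part_sum le) auto
  ultimately show ?thesis
    unfolding ker
    by (intro ideal_tensor_algI) (auto simp: hom_part_add low_part_add low_part_of_below)
qed

end

section \<open>The canonical homomorphism\<close>

lemma tensor_ideal_genideal: "tensor_ideal (Idl\<^bsub>tensor_alg\<^esub> S)"
  using ring.genideal_ideal[OF ring_tensor_alg, of S] by (simp add: tensor_ideal_def)

lemma genideal_subset: "S \<subseteq> Idl\<^bsub>tensor_alg\<^esub> S"
  using ring.genideal_self[OF ring_tensor_alg, of S] by simp

lemma genideal_least: "ideal K tensor_alg \<Longrightarrow> S \<subseteq> K \<Longrightarrow> Idl\<^bsub>tensor_alg\<^esub> S \<subseteq> K"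
  using ring.genideal_minimal[OF ring_tensor_alg] by simp

lemma ideal_imp_subspace:
  assumes "ideal K tensor_alg"
  shows "module.subspace scale K"
proof -
  interpret K: tensor_ideal K using assms by (rule tensor_ideal.intro)
  show ?thesis
    by (simp add: module.subspace_def[OF module_scale] K.add_mem K.scale_mem)
qed

text \<open>An ideal of T(U) is a subspace, so one that contains the quadratic relations contains
  their span and the ideal generated by it.\<close>

lemma quad_ideal_subset:
  assumes "ideal K tensor_alg" "\<And>k l. quad_rel hbar k l \<in> K"
  shows "quad_ideal hbar \<subseteq> K"
  unfolding quad_ideal_def quad_space_def
  by (intro genideal_least[OF assms(1)] module.span_minimal[OF module_scale _ ideal_imp_subspace])
    (use assms in auto)

lemma quad_rel_eq: "quad_rel hbar k l =
    Poly_Mapping.single [k, l] (witt_exp hbar k) - Poly_Mapping.single [l, k] (witt_exp hbar l)"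
  by (rule poly_mapping_eqI)
    (simp add: quad_rel_def e_mult_e lookup_minus lookup_scale lookup_single when_def)

lemma witt_rel_mem: "witt_rel hbar k l \<in> witt_ideal hbar"
  unfolding witt_ideal_def by (rule subsetD[OF genideal_subset]) blast

interpretation W: tensor_ideal "witt_ideal hbar" for hbar
  unfolding witt_ideal_def by (rule tensor_ideal_genideal)

interpretation Q: tensor_ideal "quad_ideal hbar" for hbar
  unfolding quad_ideal_def by (rule tensor_ideal_genideal)

lemma witt_alg_filt: "witt_filt hbar = W.filt hbar"
  by (simp add: fun_eq_iff witt_filt_def)

lemma gr_witt_eq: "gr_witt hbar = gr_alg (quot_alg tensor_alg (witt_ideal hbar)) (W.filt hbar)"
  by (simp add: gr_witt_def witt_alg_def witt_alg_filt)

text \<open>Modulo the Witt ideal a quadratic relation equals a linear term, which is zero in F(2) /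
  F(1). Hence \<open>gr_map\<close> factors through the quadratic algebra.\<close>

lemma gr_map_quad_ideal:
  assumes "x \<in> quad_ideal hbar"
  shows "W.gr_map hbar x = W.gr_map hbar 0"
proof -
  have "quad_rel hbar k l \<in> {x. W.gr_map hbar x = W.gr_map hbar 0}" for k l
  proof -
    define u where "u = scale ((witt_exp hbar l - witt_exp hbar k) / of_real hbar) (e (k + l))"
    have u: "u \<in> tensor_below 2"
      unfolding u_def
      by (intro tensor_below_scale) (auto simp: tensor_below_def e_def)
    have "quad_rel hbar k l - u \<in> witt_ideal hbar"
      using witt_rel_mem[of hbar k l] by (simp add: witt_rel_def quad_rel_def u_def)
    then have "quad_rel hbar k l \<in> W.low_part hbar 2"
      using u by (auto simp: W.low_part_def)
    moreover have "hom_part n (quad_rel hbar k l) = (if n = 2 then quad_rel hbar k l else 0)" for n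
      by (auto simp: quad_rel_eq hom_part_diff hom_part_single)
    ultimately show ?thesis
      by (simp add: W.gr_map_eq_iff W.low_part_of_mem)
  qed
  then show ?thesis
    using quad_ideal_subset[OF W.ideal_gr_map_kernel] assms by blast
qed

lemma gr_map_e: "W.gr_map hbar (e k) =
    gr_class (witt_alg hbar) (witt_filt hbar) 1 (witt_ideal hbar +>\<^bsub>tensor_alg\<^esub> e k)"
  by (simp add: witt_alg_def witt_alg_filt W.gr_class_homogeneous e_def hom_part_single)

lemma ex_canonical_hom: "\<exists>\<phi>. is_canonical_hom hbar \<phi>"
proof
  \<comment> \<open>Any representative will do: by \<open>gr_map_quad_ideal\<close> the value
    depends only on the coset.\<close>
  define \<phi> where "\<phi> X = W.gr_map hbar (SOME x. x \<in> X)" for X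
  have \<phi>: "\<phi> (quad_ideal hbar +>\<^bsub>tensor_alg\<^esub> x) = W.gr_map hbar x" for x
  proof -
    let ?y = "SOME y. y \<in> Q.proj hbar x"
    have "?y \<in> Q.proj hbar x"
      by (rule someI[of _ x]) (simp add: Q.mem_proj_iff)
    then have "W.gr_map hbar (?y - x) = W.gr_map hbar 0"
      by (intro gr_map_quad_ideal) (simp add: Q.mem_proj_iff)
    then show ?thesis by (simp add: \<phi>_def W.gr_map_eq_iff)
  qed
  show "is_canonical_hom hbar \<phi>"
    unfolding is_canonical_hom_def alg_hom_def quad_alg_def
  proof (intro conjI CollectI allI ballI)
    show "\<phi> \<in> ring_hom (quot_alg tensor_alg (quad_ideal hbar)) (gr_witt hbar)"
      by (rule ring_hom_memI)
        (auto simp: \<phi> Q.carrier_A Q.add_A Q.mult_A Q.one_A gr_witt_eq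
          W.gr_map_in_carrier W.gr_map_add W.gr_map_mult W.gr_map_one)
  next
    fix c X assume "X \<in> carrier (quot_alg tensor_alg (quad_ideal hbar))"
    then show "\<phi> (smult (quot_alg tensor_alg (quad_ideal hbar)) c X) = smult (gr_witt hbar) c (\<phi> X)"
      by (auto simp: \<phi> Q.carrier_A Q.smult_A gr_witt_eq W.gr_map_smult)
  qed (simp only: \<phi> gr_map_e)
qed

text \<open>Uniqueness: the values on the \<open>e k\<close> determine those on words by
  multiplicativity, on monomials by scaling and on all tensors by additivity.\<close>

lemma canonical_hom_eq_gr_map:
  assumes "is_canonical_hom hbar \<phi>"
  shows "\<phi> (quad_ideal hbar +>\<^bsub>tensor_alg\<^esub> x) = W.gr_map hbar x"
proof -
  have hom: "\<phi> \<in> ring_hom (quot_alg tensor_alg (quad_ideal hbar)) (gr_witt hbar)"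
    using assms unfolding is_canonical_hom_def alg_hom_def quad_alg_def by blast
  have carrier: "Q.proj hbar x \<in> carrier (quot_alg tensor_alg (quad_ideal hbar))" for x
    unfolding Q.carrier_A by (rule rangeI)
  have plus: "\<phi> (Q.proj hbar (x + y)) = add (gr_witt hbar) (\<phi> (Q.proj hbar x)) (\<phi> (Q.proj hbar y))" for x y
    using ring_hom_add[OF hom carrier[of x] carrier[of y]] by (simp only: Q.add_A)
  have mult: "\<phi> (Q.proj hbar (x * y)) =
      monoid.mult (gr_witt hbar) (\<phi> (Q.proj hbar x)) (\<phi> (Q.proj hbar y))" for x y
    using ring_hom_mult[OF hom carrier[of x] carrier[of y]] by (simp only: Q.mult_A)
  have one: "\<phi> (Q.proj hbar 1) = one (gr_witt hbar)"
    using ring_hom_one[OF hom] by (simp only: Q.one_A)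
  have smult: "\<phi> (Q.proj hbar (scale c x)) = smult (gr_witt hbar) c (\<phi> (Q.proj hbar x))" for c x
    using assms carrier[of x] unfolding is_canonical_hom_def alg_hom_def quad_alg_def
      Q.smult_A[symmetric] by blast
  have gen: "\<phi> (Q.proj hbar (e k)) = W.gr_map hbar (e k)" for k
    unfolding gr_map_e using assms unfolding is_canonical_hom_def by blast
  have word: "\<phi> (Q.proj hbar (Poly_Mapping.single w 1)) = W.gr_map hbar (Poly_Mapping.single w 1)" for w
  proof (induction w)
    case Nil
    show ?case by (simp add: single_Nil_one one gr_witt_eq W.gr_map_one)
  next
    case (Cons k w)
    have "Poly_Mapping.single (k # w) 1 = e k * Poly_Mapping.single w 1"
      by (simp add: e_def mult_single plus_list_def)
    then show ?case using Cons by (simp add: mult gen gr_witt_eq W.gr_map_mult)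
  qed
  show ?thesis
  proof (induction x rule: tensor_induct)
    case (single w c)
    have "Poly_Mapping.single w c = scale c (Poly_Mapping.single w 1)"
      by (rule poly_mapping_eqI) (simp add: lookup_scale lookup_single when_def)
    then show ?case by (simp add: smult word gr_witt_eq W.gr_map_smult)
  next
    case (add x y)
    then show ?case
      by (simp only: plus gr_witt_eq W.gr_map_add)
  qed
qed

section \<open>An element of the kernel\<close>

text \<open>The diamond computation with letters \<open>x\<close>, \<open>y\<close>,
  \<open>z\<close> and central coefficients. One path first reorders \<open>y * z\<close>, the other
  first \<open>x * y\<close>; both end in the same multiple of \<open>z * (y * x)\<close>, so only
  quadratic terms remain.\<close>

lemma overlap_identity:
  fixes x y z :: "'a::ring_1"
  assumes central: "\<And>t. pab * t = t * pab" "\<And>t. pac * t = t * pac" "\<And>t. pbc * t = t * pbc"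
    "\<And>t. bab * t = t * bab" "\<And>t. bac * t = t * bac" "\<And>t. bbc * t = t * bbc"
  shows
    "(x * (y * z - pbc * (z * y) - bbc * w) + pbc * ((x * z - pac * (z * x) - bac * v) * y)
        + pbc * pac * (z * (x * y - pab * (y * x) - bab * u)))
      - ((x * y - pab * (y * x) - bab * u) * z + pab * (y * (x * z - pac * (z * x) - bac * v))
        + pab * pac * ((y * z - pbc * (z * y) - bbc * w) * x))
    = bbc * (pab * pac * (w * x) - x * w) + bac * (pab * (y * v) - pbc * (v * y))
      + bab * (u * z - pbc * pac * (z * u))"
proof -
  have left: "t * (p * s) = p * (t * s)" if "\<And>t. p * t = t * p" for p t s :: 'a
    using that by (metis mult.assoc)
  note comm = left[OF central(1)] left[OF central(2)] left[OF central(3)]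
    left[OF central(4)] left[OF central(5)] left[OF central(6)]
  \<comment> \<open>Instances directed so that scalars move to the left in the order b, pab, pac, pbc; the
    general rules would loop on products of two scalars.\<close>
  show ?thesis
    by (simp add: algebra_simps comm[of x] comm[of y] comm[of z]
        comm(4-6)[of pab] comm(4-6)[of pac] comm(4-6)[of pbc]
        comm(1)[of pac] comm(1)[of pbc] comm(2)[of pbc])
qed

text \<open>
  With \<open>q = exp (\<i> \<hbar>)\<close>, this is the difference of the two normal forms of \<open>e 1 * e 2 * e 4\<close> under
  \<open>e k * e l \<rightarrow> q\<^bsup>l-k\<^esup> e l * e k + ((q\<^bsup>l-k\<^esup> - 1) / \<hbar>) e (k + l)\<close> for \<open>k < l\<close>, before
  the quadratic terms are reordered.
\<close>

definition overlap_elem :: "complex \<Rightarrow> complex \<Rightarrow> tensor"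
  where "overlap_elem h q =
    scale ((q ^ 2 - 1) / h) (scale (q * q ^ 3) (e 6 * e 1) - e 1 * e 6)
      + scale ((q ^ 3 - 1) / h) (scale q (e 2 * e 5) - scale (q ^ 2) (e 5 * e 2))
      + scale ((q - 1) / h) (e 3 * e 4 - scale (q ^ 2 * q ^ 3) (e 4 * e 3))"

lemma witt_exp_conv_power: "witt_exp hbar (int n) = exp (\<i> * of_real hbar) ^ n"
  by (simp add: witt_exp_def mult_ac flip: exp_of_nat_mult)

text \<open>Dividing a Witt relation by its leading coefficient turns it into a rewriting
  rule.\<close>

lemma normalized_witt_rel_mem:
  assumes "witt_exp hbar l = p * witt_exp hbar k"
  shows "e k * e l - scale p (e l * e k) - scale ((p - 1) / of_real hbar) (e (k + l))
    \<in> witt_ideal hbar" (is "?R \<in> _")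
proof -
  have [simp]: "witt_exp hbar k \<noteq> 0" by (simp add: witt_exp_def)
  have "?R = scale (1 / witt_exp hbar k) (witt_rel hbar k l)"
    by (rule poly_mapping_eqI)
      (simp add: witt_rel_def assms lookup_scale lookup_minus divide_simps, simp add: algebra_simps)
  then show ?thesis by (simp add: W.scale_mem witt_rel_mem)
qed

lemma overlap_elem_in_witt_ideal:
  "overlap_elem (of_real hbar) (exp (\<i> * of_real hbar)) \<in> witt_ideal hbar"
proof -
  define q where "q = exp (\<i> * complex_of_real hbar)"
  define h where "h = complex_of_real hbar"
  have exps: "witt_exp hbar 1 = q" "witt_exp hbar 2 = q ^ 2" "witt_exp hbar 4 = q ^ 4"
    using witt_exp_conv_power[of hbar 1] witt_exp_conv_power[of hbar 2] witt_exp_conv_power[of hbar 4]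
    by (simp_all add: q_def)
  \<comment> \<open>The powers of \<open>q\<close> are the index differences. The sums 3, 5, 6 of
    pairs from 1, 2, 4 leave quadratic words on the disjoint letter pairs {1, 6}, {2, 5}, {3,
    4}.\<close>
  define R12 where "R12 = e 1 * e 2 - scale q (e 2 * e 1) - scale ((q - 1) / h) (e 3)"
  define R14 where "R14 = e 1 * e 4 - scale (q ^ 3) (e 4 * e 1) - scale ((q ^ 3 - 1) / h) (e 5)"
  define R24 where "R24 = e 2 * e 4 - scale (q ^ 2) (e 4 * e 2) - scale ((q ^ 2 - 1) / h) (e 6)"
  have R: "R12 \<in> witt_ideal hbar" "R14 \<in> witt_ideal hbar" "R24 \<in> witt_ideal hbar"
    using normalized_witt_rel_mem[of hbar 2 q 1] normalized_witt_rel_mem[of hbar 4 "q ^ 3" 1]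
      normalized_witt_rel_mem[of hbar 4 "q ^ 2" 2]
    by (simp_all add: exps R12_def R14_def R24_def h_def power_numeral_reduce)
  let ?c = "Poly_Mapping.single ([] :: int list)"
  have central: "?c a * t = t * ?c a" for a :: complex and t
    by (metis scale_conv_mult scale_conv_mult_right)
  have "overlap_elem h q =
      (e 1 * R24 + ?c (q ^ 2) * (R14 * e 2) + ?c (q ^ 2) * ?c (q ^ 3) * (e 4 * R12))
      - (R12 * e 4 + ?c q * (e 2 * R14) + ?c q * ?c (q ^ 3) * (R24 * e 1))"
    unfolding R12_def R14_def R24_def scale_conv_mult
      overlap_identity[of "?c q" "?c (q ^ 3)" "?c (q ^ 2)" "?c ((q - 1) / h)" "?c ((q ^ 3 - 1) / h)"
        "?c ((q ^ 2 - 1) / h)", OF central central central central central central]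
    by (simp add: overlap_elem_def scale_conv_mult mult_single plus_list_def)
  also have "\<dots> \<in> witt_ideal hbar"
    by (intro W.diff_mem W.add_mem W.mult_mem_left W.mult_mem_right R)
  finally show ?thesis by (simp add: q_def h_def)
qed

section \<open>The overlap element modulo the quadratic relations\<close>

lemma hom_part_overlap_elem: "hom_part n (overlap_elem h q) = (if n = 2 then overlap_elem h q else 0)"
  by (simp add: overlap_elem_def hom_part_add hom_part_diff hom_part_scale e_mult_e hom_part_single
      module.scale_zero_right[OF module_scale])

text \<open>A necessary condition for membership, to be refuted for the overlap element at the words
  \<open>[1, 6]\<close> and \<open>[6, 1]\<close>.\<close>

lemma quad_ideal_lookup:
  assumes "k \<noteq> l" "x \<in> quad_ideal hbar"
  shows "witt_exp hbar l * Poly_Mapping.lookup x [k, l] + witt_exp hbar k * Poly_Mapping.lookup x [l, k] = 0"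
proof -
  \<comment> \<open>\<open>L\<close> kills all quadratic relations and reads off the degree two part only, so it kills the
    ideal, in whose elements the parts of degree zero and one vanish.\<close>
  define L where "L x = witt_exp hbar l * Poly_Mapping.lookup x [k, l]
    + witt_exp hbar k * Poly_Mapping.lookup x [l, k]" for x :: tensor
  define K where "K = {x. hom_part 0 x = 0 \<and> hom_part 1 x = 0 \<and> L x = 0}"
  have L_add: "L (x + y) = L x + L y" for x y
    by (simp add: L_def lookup_add algebra_simps)
  have L_scale: "L (scale c x) = c * L x" for c x
    by (simp add: L_def lookup_scale algebra_simps)
  have L_hom_part: "L (hom_part 2 x) = L x" for x
    by (simp add: L_def lookup_hom_part)
  have "ideal K tensor_alg"
  proof (rule ideal_tensor_algI)
    fix x y assume x: "x \<in> K"
    \<comment> \<open>As \<open>x\<close> has no components of degree 0 and 1, only the constant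
      term of \<open>y\<close> reaches degree two; \<open>L\<close> is merely multiplied by that
      constant.\<close>
    have "hom_part 2 (y * x) = hom_part 0 y * hom_part 2 x"
      "hom_part 2 (x * y) = hom_part 2 x * hom_part 0 y"
      "hom_part 1 (y * x) = 0" "hom_part 1 (x * y) = 0" "hom_part 0 (y * x) = 0" "hom_part 0 (x * y) = 0"
      using x by (simp_all add: hom_part_mult K_def numeral_2_eq_2)
    then have "L (y * x) = 0" "L (x * y) = 0"
      using x L_hom_part[of "y * x"] L_hom_part[of "x * y"]
      by (simp_all add: hom_part_0 L_scale L_hom_part K_def
          flip: scale_conv_mult scale_conv_mult_right)
    then show "y * x \<in> K" "x * y \<in> K"
      using \<open>hom_part 1 (y * x) = 0\<close> \<open>hom_part 1 (x * y) = 0\<close>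
        \<open>hom_part 0 (y * x) = 0\<close> \<open>hom_part 0 (x * y) = 0\<close> by (simp_all add: K_def)
  next
    show "0 \<in> K" by (simp add: K_def L_def)
  qed (simp add: K_def L_add hom_part_add)
  moreover have "quad_rel hbar a b \<in> K" for a b
    using assms(1)
    by (auto simp: K_def L_def quad_rel_eq hom_part_diff hom_part_single lookup_minus lookup_single when_def)
  ultimately have "quad_ideal hbar \<subseteq> K"
    by (rule quad_ideal_subset)
  then show ?thesis using assms(2) by (auto simp: K_def L_def)
qed

lemma overlap_elem_notin_quad_ideal:
  fixes hbar :: real
  defines "q \<equiv> exp (\<i> * of_real hbar)"
  assumes "hbar \<noteq> 0" "q \<noteq> 1" "q ^ 2 \<noteq> 1"
  shows "overlap_elem (of_real hbar) q \<notin> quad_ideal hbar"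
proof
  let ?b = "(q ^ 2 - 1) / of_real hbar"
  assume "overlap_elem (of_real hbar) q \<in> quad_ideal hbar"
  then have "witt_exp hbar 6 * Poly_Mapping.lookup (overlap_elem (of_real hbar) q) [1, 6]
    + witt_exp hbar 1 * Poly_Mapping.lookup (overlap_elem (of_real hbar) q) [6, 1] = 0"
    by (intro quad_ideal_lookup) simp_all
  moreover have "Poly_Mapping.lookup (overlap_elem (of_real hbar) q) [1, 6] = - ?b"
    "Poly_Mapping.lookup (overlap_elem (of_real hbar) q) [6, 1] = ?b * q ^ 4"
    by (simp_all add: overlap_elem_def e_mult_e lookup_add lookup_minus lookup_scale
        lookup_single power_numeral_reduce)
  moreover have "witt_exp hbar 1 = q" "witt_exp hbar 6 = q ^ 6"
    using witt_exp_conv_power[of hbar 1] witt_exp_conv_power[of hbar 6] by (simp_all add: q_def)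
  \<comment> \<open>The two contributions are \<open>- ?b * q ^ 6\<close> and
    \<open>?b * q ^ 5\<close>. Here \<open>?b\<close> is nonzero because
    \<open>q ^ 2 \<noteq> 1\<close>, and \<open>1 - q\<close> because
    \<open>q \<noteq> 1\<close>.\<close>
  ultimately have "?b * q ^ 5 * (1 - q) = 0"
    by (auto simp: algebra_simps power_numeral_reduce)
  moreover have "q \<noteq> 0" by (simp add: q_def)
  ultimately show False using assms by simp
qed

text \<open>The canonical homomorphism is specified by a predicate; the existence clause keeps the
  universal clause from being vacuous. Surjectivity holds, so what fails is injectivity.\<close>

theorem mainTheorem5:
  fixes hbar :: real
  assumes "hbar \<noteq> 0"
    and "\<forall>n::nat. n > 0 \<longrightarrow> exp (\<i> * complex_of_real hbar) ^ n \<noteq> 1"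
  shows "(\<exists>\<phi>. is_canonical_hom hbar \<phi>) \<and>
    (\<forall>\<phi>. is_canonical_hom hbar \<phi> \<longrightarrow>
      \<phi> ` carrier (quad_alg hbar) = carrier (gr_witt hbar) \<and>
      \<phi> \<notin> alg_iso (quad_alg hbar) (gr_witt hbar))"
proof (intro conjI allI impI)
  show "\<exists>\<phi>. is_canonical_hom hbar \<phi>" by (rule ex_canonical_hom)
next
  fix \<phi> assume "is_canonical_hom hbar \<phi>"
  note \<phi> = canonical_hom_eq_gr_map[OF this]
  have "\<phi> ` carrier (quad_alg hbar) = range (W.gr_map hbar)"
    unfolding quad_alg_def Q.carrier_A image_image \<phi> ..
  then show "\<phi> ` carrier (quad_alg hbar) = carrier (gr_witt hbar)"
    unfolding gr_witt_eq W.range_gr_map .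
  define d where "d = overlap_elem (of_real hbar) (exp (\<i> * of_real hbar))"
  have "d \<in> witt_ideal hbar"
    unfolding d_def by (rule overlap_elem_in_witt_ideal)
  \<comment> \<open>The component of \<open>d\<close> in degree two is \<open>d\<close> itself,
    which lies in the Witt ideal; all other components are zero.\<close>
  then have "W.gr_map hbar d = W.gr_map hbar 0"
    by (simp add: W.gr_map_eq_iff d_def hom_part_overlap_elem W.low_part_of_mem)
  then have eq: "\<phi> (Q.proj hbar d) = \<phi> (Q.proj hbar 0)" unfolding \<phi> .
  have "d \<notin> quad_ideal hbar"
    unfolding d_def using assms(1) assms(2)[rule_format, of 1] assms(2)[rule_format, of 2]
    by (intro overlap_elem_notin_quad_ideal) simp_all
  then have neq: "Q.proj hbar d \<noteq> Q.proj hbar 0" by (simp add: Q.proj_eq_iff)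
  have "\<not> inj_on \<phi> (carrier (quad_alg hbar))"
    unfolding quad_alg_def Q.carrier_A using eq neq by (meson inj_onD rangeI)
  then show "\<phi> \<notin> alg_iso (quad_alg hbar) (gr_witt hbar)"
    unfolding alg_iso_def bij_betw_def by blast
qed

end
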